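(* Let $\tilde M$ be a matroid on a finite ground set $\tilde E\neq\emptyset$, and let $k$ and $p$ be non-negative integers. Assume there is a subset $E\neq\emptyset$ of $\tilde E$ such that $$|A|\le k\cdot\operatorname{rk}_{\tilde M}(A)-p$$ for each non-empty subset $A\subseteq E$, and fix an integer $q$ with $0\le q\le p$. Then, for each $q$-tuple $(e_1,\dots,e_q)\in\tilde E^q$, there are disjoint independent sets $\tilde I_1,\dots,\tilde I_q$ of $E$ with the following property: if $(a_1,\dots,a_p)\in\tilde E^p$ is a $p$-tuple whose first $q$ entries are $e_1,\dots,e_q$ (that is, $a_i=e_i$ for $1\le i\le q$), then there is a partition $E=I_1\sqcup\cdots\sqcup I_k$ into independent sets such that $a_j\notin\operatorname{Cl}(I_j)$ whenever $1\le j\le p$, and $I_j=\tilde I_j$ for $j=1,\dots,q$.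
   Context: $\operatorname{rk}_{\tilde M}$ is the rank function of $\tilde M$. Independence is independence in $\tilde M$, and the closure is taken in $\tilde M$: $\operatorname{Cl}(A)=\{e\in\tilde E\mid\operatorname{rk}_{\tilde M}(A\cup\{e\})=\operatorname{rk}_{\tilde M}(A)\}$. In a partition $E=I_1\sqcup\cdots\sqcup I_k$ (disjoint union) the parts are allowed to be empty.
   Formalization: The entries of the p-tuple (a_1,…,a_p) are additionally required to be non-loops of the matroid, since a loop lies in the closure of every set and the claim as written fails for tuples containing one. *)

theory Defs
  imports Main "HOL-Library.FuncSet" "HOL-Library.Disjoint_Sets"
begin

locale matroid =
  fixes carrier :: "'a set" and indep :: "'a set \<Rightarrow> bool"
  assumes finite_carrier: "finite carrier"
    and indep_subset_carrier: "indep X \<Longrightarrow> X \<subseteq> carrier"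
    and indep_empty: "indep {}"
    and indep_subset: "indep X \<Longrightarrow> Y \<subseteq> X \<Longrightarrow> indep Y"
    and indep_augment:
      "indep X \<Longrightarrow> indep Y \<Longrightarrow> card X < card Y \<Longrightarrow> \<exists>y\<in>Y - X. indep (insert y X)"
begin

text \<open>The maximum is over a finite non-empty set, since independent sets lie in
  the finite carrier and the empty set is independent.\<close>

definition rk :: "'a set \<Rightarrow> nat" where
  "rk A = Max (card ` {X. X \<subseteq> A \<and> indep X})"

definition closure :: "'a set \<Rightarrow> 'a set" where
  "closure A = {e \<in> carrier. rk (A \<union> {e}) = rk A}"

text \<open>A loop lies in the closure of every set, so no set can have a closure avoiding it;
  this is why the theorem asks for tuples of non-loops.\<close>

definition loop :: "'a \<Rightarrow> bool" where
  "loop e \<longleftrightarrow> e \<in> carrier \<and> \<not> indep {e}"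

end

end

theory Submission
  imports Defs
begin

text \<open>
  The tuple is realised one entry at a time, so that \<open>I\<^sub>j\<close> depends only on
  \<open>a\<^sub>1, \<dots>, a\<^sub>j\<close>; this is what makes the first \<open>q\<close> parts independent of the
  rest of the tuple. Call a set \<open>(k, p)\<close>-sparse if all its non-empty subsets satisfy
  \<open>\<bar>A\<bar> \<le> k \<sqdot> rk A - p\<close>. The point (lemma \<open>sparse_split_off\<close>) is that from a
  \<open>(k, p)\<close>-sparse set with \<open>0 < p < k\<close> one can remove an independent set \<open>I\<close> with
  \<open>x \<notin> Cl I\<close>, for a given non-loop \<open>x\<close>, such that the remainder is
  \<open>(k - 1, p - 1)\<close>-sparse. After \<open>p\<close>
  such steps the second parameter stays 0 and the parts merely have to be independent; after
  \<open>k\<close> steps the remainder is \<open>(0, 0)\<close>-sparse, hence empty.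

  The existence of \<open>I\<close> is a matroid union problem. One summand is the contraction of \<open>x\<close>,
  with rank function \<open>r A = rk (A \<union> {x}) - 1\<close>. The other consists of the
  \<open>(k - 1, p - 1)\<close>-sparse sets, which are defined by \<open>f A = (k - 1) \<sqdot> rk A - (p - 1)\<close>.
  This function is submodular, but its value at the empty set may be negative. If that value is
  reset to 0, the submodular inequality can fail for disjoint pairs of sets and survives only for
  intersecting ones, and \<open>f\<close> has to be replaced by its Dilworth truncation, the minimum of
  \<open>f A\<^sub>1 + \<dots> + f A\<^sub>m\<close> over the partitions of a set into non-empty blocks. A Hall-type condition then suffices for the
  existence of \<open>I\<close> (lemma \<open>submodular_split\<close>):
  \<open>\<bar>A\<bar> \<le> r A + f A\<^sub>1 + \<dots> + f A\<^sub>m\<close> for every partition of \<open>A\<close>. Write \<open>S\<close> for the sum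
  of the ranks of the blocks. For \<open>p > 0\<close> the condition is obtained by adding up the sparsity
  inequalities of the blocks if \<open>S < rk A + m\<close>, and otherwise from the sparsity inequality of \<open>A\<close> and the
  excess of \<open>S\<close> over \<open>rk A\<close>, where \<open>p < k\<close> enters. For \<open>p = 0\<close> no point has to be avoided,
  the matroid itself takes the place of the contraction with \<open>f A = (k - 1) \<sqdot> rk A\<close>, and
  \<open>rk A \<le> S\<close> suffices.
\<close>

section \<open>Dilworth truncation\<close>

text \<open>The truncation is represented by the values attained at partitions. Working
  with the attained values in place of their minimum lets all proofs go by induction on the
  number of blocks.\<close>

inductive partition_sum :: "('a set \<Rightarrow> int) \<Rightarrow> 'a set \<Rightarrow> int \<Rightarrow> bool" for f where
  empty: "partition_sum f {} 0"
| add_block: "partition_sum f A n \<Longrightarrow> C \<noteq> {} \<Longrightarrow> A \<inter> C = {} \<Longrightarrow> partition_sum f (A \<union> C) (n + f C)"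

lemma partition_sum_single: "A \<noteq> {} \<Longrightarrow> partition_sum f A (f A)"
  using add_block[OF empty, of A f] by simp

lemma partition_sum_disjoint_union:
  assumes "partition_sum f B m" "partition_sum f A n" "A \<inter> B = {}"
  shows "partition_sum f (A \<union> B) (n + m)"
  using assms
proof induction
  case empty
  then show ?case by simp
next
  case (add_block B m C)
  then have "partition_sum f (A \<union> B) (n + m)" "(A \<union> B) \<inter> C = {}" by auto
  from partition_sum.add_block[OF this(1) add_block.hyps(2) this(2)]
  show ?case by (simp add: ac_simps)
qed

text \<open>The value at the empty set is left unconstrained, since only non-empty sets are blocks.\<close>

definition intersecting_submodular :: "('a set \<Rightarrow> int) \<Rightarrow> bool" where
  "intersecting_submodular f \<longleftrightarrow> (\<forall>A B. A \<inter> B \<noteq> {} \<longrightarrow> f (A \<union> B) + f (A \<inter> B) \<le> f A + f B)"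

text \<open>The blocks that meet \<open>C\<close> are merged into \<open>C\<close> one after the other. Since the
  blocks are disjoint, the intersection cut off from a block \<open>P\<close> is always \<open>C \<inter> P\<close>, however
  many blocks have been merged before.\<close>

lemma partition_sum_uncross_block:
  assumes f: "intersecting_submodular f"
    and "partition_sum f A n" "C \<noteq> {}"
  shows "\<exists>u w. partition_sum f (A \<union> C) u \<and> partition_sum f (A \<inter> C) w \<and> u + w \<le> n + f C"
  using assms(2,3)
proof (induction arbitrary: C)
  case empty
  then show ?case using partition_sum_single[of C f] partition_sum.empty[of f]
    by (intro exI[of _ "f C"] exI[of _ 0]) simp
next
  case (add_block A n P)
  show ?case
  proof (cases "P \<inter> C = {}")
    case True
    obtain u w where uw: "partition_sum f (A \<union> C) u" "partition_sum f (A \<inter> C) w" "u + w \<le> n + f C"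
      using add_block.IH[OF add_block.prems] by blast
    have "partition_sum f (A \<union> C \<union> P) (u + f P)"
      using uw(1) add_block.hyps True by (intro partition_sum.add_block) auto
    then have "partition_sum f (A \<union> P \<union> C) (u + f P)" by (simp only: ac_simps)
    moreover have "A \<inter> C = (A \<union> P) \<inter> C" using True by auto
    then have "partition_sum f ((A \<union> P) \<inter> C) w" using uw(2) by (simp only:)
    moreover have "u + f P + w \<le> n + f P + f C" using uw(3) by simp
    ultimately show ?thesis by blast
  next
    case False
    have "C \<union> P \<noteq> {}" using add_block.prems by auto
    from add_block.IH[OF this] obtain u w where
      uw: "partition_sum f (A \<union> (C \<union> P)) u" "partition_sum f (A \<inter> (C \<union> P)) w" "u + w \<le> n + f (C \<union> P)"
      by blast
    have *: "A \<inter> (C \<union> P) = A \<inter> C" using add_block.hyps by auto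
    have "partition_sum f (A \<inter> C \<union> C \<inter> P) (w + f (C \<inter> P))"
      using uw(2) add_block.hyps False unfolding * by (intro partition_sum.add_block) auto
    moreover have "A \<inter> C \<union> C \<inter> P = (A \<union> P) \<inter> C" by auto
    ultimately have V2: "partition_sum f ((A \<union> P) \<inter> C) (w + f (C \<inter> P))" by (simp only:)
    have V1: "partition_sum f (A \<union> P \<union> C) u" using uw(1) by (simp only: ac_simps)
    have "f (C \<union> P) + f (C \<inter> P) \<le> f C + f P"
      using f False unfolding intersecting_submodular_def by (metis Int_commute)
    then have le: "u + (w + f (C \<inter> P)) \<le> n + f P + f C" using uw(3) by linarith
    show ?thesis using V1 V2 le by blast
  qed
qed

text \<open>Hence the truncation is submodular on all pairs of sets.\<close>

lemma partition_sum_uncross: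
  assumes f: "intersecting_submodular f"
    and A: "partition_sum f A n" and B: "partition_sum f B m"
  shows "\<exists>u w. partition_sum f (A \<union> B) u \<and> partition_sum f (A \<inter> B) w \<and> u + w \<le> n + m"
  using B
proof induction
  case empty
  then show ?case using A partition_sum.empty[of f] by (intro exI[of _ n] exI[of _ 0]) simp
next
  case (add_block B m C)
  obtain u w where uw: "partition_sum f (A \<union> B) u" "partition_sum f (A \<inter> B) w" "u + w \<le> n + m"
    using add_block.IH by blast
  obtain u' w' where uw': "partition_sum f (A \<union> B \<union> C) u'" "partition_sum f ((A \<union> B) \<inter> C) w'"
    "u' + w' \<le> u + f C"
    using partition_sum_uncross_block[OF f uw(1) add_block.hyps(2)] by blast
  have *: "(A \<union> B) \<inter> C = A \<inter> C" using add_block.hyps by auto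
  have "partition_sum f (A \<inter> B \<union> A \<inter> C) (w + w')"
    using uw'(2) uw(2) add_block.hyps unfolding * by (intro partition_sum_disjoint_union) auto
  then have "partition_sum f (A \<inter> (B \<union> C)) (w + w')" by (simp only: Int_Un_distrib)
  moreover have "partition_sum f (A \<union> (B \<union> C)) u'" using uw'(1) by (simp only: Un_assoc)
  moreover have "u' + (w + w') \<le> n + (m + f C)" using uw(3) uw'(3) by linarith
  ultimately show ?case by blast
qed

section \<open>Splitting a set between two submodular functions\<close>

text \<open>This is the argument of Rado's theorem on independent transversals. The sets \<open>P\<close> and
  \<open>Q\<close> contain the elements that may still go to the first and to the second part. If neither of
  the two possibilities for an undecided element \<open>x\<close> could be discarded, then uncrossing
  the two violated inequalities would give a violated one before the decision.\<close>

lemma submodular_split_undecided: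
  fixes r :: "'a set \<Rightarrow> int"
  assumes fin: "finite E" and r: "\<And>A B. r (A \<union> B) + r (A \<inter> B) \<le> r A + r B" "r {} = 0"
    and f: "intersecting_submodular f"
    and "P \<union> Q = E"
    and "\<And>K n. K \<subseteq> E \<Longrightarrow> partition_sum f (K \<inter> Q) n \<Longrightarrow> int (card K) \<le> r (K \<inter> P) + n"
  shows "\<exists>I\<subseteq>E. (\<forall>K\<subseteq>I. int (card K) \<le> r K) \<and> (\<forall>K\<subseteq>E - I. K \<noteq> {} \<longrightarrow> int (card K) \<le> f K)"
  using assms(5,6)
proof (induction "card (P \<inter> Q)" arbitrary: P Q rule: less_induct)
  case less
  note cover = less.prems(1) and hall = less.prems(2)
  have fins: "finite P" "finite Q" using fin cover by (metis finite_Un)+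
  show ?case
  proof (cases "P \<inter> Q = {}")
    case True
    have "int (card K) \<le> r K" if "K \<subseteq> P" for K
    proof -
      have "K \<inter> Q = {}" "K \<inter> P = K" "K \<subseteq> E" using that True cover by auto
      then show ?thesis using hall[of K 0] partition_sum.empty[of f] by simp
    qed
    moreover have "int (card K) \<le> f K" if "K \<subseteq> E - P" "K \<noteq> {}" for K
    proof -
      have "K \<inter> P = {}" "K \<inter> Q = K" "K \<subseteq> E" using that cover by auto
      then show ?thesis using hall[of K "f K"] partition_sum_single[of K f] that r(2) by simp
    qed
    ultimately show ?thesis using cover by blast
  next
    case False
    then obtain x where x: "x \<in> P" "x \<in> Q" by auto
    have smaller: "card ((P - {x}) \<inter> Q) < card (P \<inter> Q)" "card (P \<inter> (Q - {x})) < card (P \<inter> Q)"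
      using x fins by (auto intro!: psubset_card_mono)
    have covers: "P - {x} \<union> Q = E" "P \<union> (Q - {x}) = E" using x cover by auto
    show ?thesis
    proof (rule ccontr)
      assume not: "\<not> ?thesis"
      obtain K n where K: "K \<subseteq> E" "partition_sum f (K \<inter> Q) n" "r (K \<inter> (P - {x})) + n < int (card K)"
        using less.hyps[OF smaller(1) covers(1)] not by (metis not_le)
      obtain L m where L: "L \<subseteq> E" "partition_sum f (L \<inter> (Q - {x})) m" "r (L \<inter> P) + m < int (card L)"
        using less.hyps[OF smaller(2) covers(2)] not by (metis not_le)
      \<comment> \<open>A violating set contains \<open>x\<close>, since otherwise it violated the condition before.\<close>
      have xK: "x \<in> K"
      proof (rule ccontr)
        assume "x \<notin> K"
        then have "K \<inter> (P - {x}) = K \<inter> P" by auto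
        then show False using hall[OF K(1,2)] K(3) by simp
      qed
      have xL: "x \<in> L"
      proof (rule ccontr)
        assume "x \<notin> L"
        then have "L \<inter> (Q - {x}) = L \<inter> Q" by auto
        then show False using hall[OF L(1)] L(2,3) by fastforce
      qed
      obtain u w where uw: "partition_sum f (K \<inter> Q \<union> L \<inter> (Q - {x})) u"
        "partition_sum f (K \<inter> Q \<inter> (L \<inter> (Q - {x}))) w" "u + w \<le> n + m"
        using partition_sum_uncross[OF f K(2) L(2)] by blast
      have s: "K \<inter> Q \<union> L \<inter> (Q - {x}) = (K \<union> L) \<inter> Q"
        "K \<inter> Q \<inter> (L \<inter> (Q - {x})) = (K \<inter> L - {x}) \<inter> Q"
        "K \<inter> (P - {x}) \<union> L \<inter> P = (K \<union> L) \<inter> P"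
        "K \<inter> (P - {x}) \<inter> (L \<inter> P) = (K \<inter> L - {x}) \<inter> P"
        using xK xL by auto
      have "int (card (K \<union> L)) \<le> r ((K \<union> L) \<inter> P) + u"
        using hall uw(1) K(1) L(1) unfolding s by auto
      moreover have "int (card (K \<inter> L - {x})) \<le> r ((K \<inter> L - {x}) \<inter> P) + w"
        using K(1) uw(2) unfolding s by (intro hall) auto
      moreover have "r ((K \<union> L) \<inter> P) + r ((K \<inter> L - {x}) \<inter> P) \<le> r (K \<inter> (P - {x})) + r (L \<inter> P)"
        using r(1)[of "K \<inter> (P - {x})" "L \<inter> P"] unfolding s .
      moreover have "finite K" "finite L" using K(1) L(1) fin finite_subset by blast+
      then have "card K + card L = card (K \<union> L) + Suc (card (K \<inter> L - {x}))"
        using xK xL card_Un_Int[of K L] card_Suc_Diff1[of "K \<inter> L" x] by simp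
      ultimately show False using K(3) L(3) uw(3) by linarith
    qed
  qed
qed

lemma submodular_split:
  fixes r :: "'a set \<Rightarrow> int"
  assumes "finite E" and "\<And>A B. r (A \<union> B) + r (A \<inter> B) \<le> r A + r B" "r {} = 0"
    and "intersecting_submodular f"
    and "\<And>K n. K \<subseteq> E \<Longrightarrow> partition_sum f K n \<Longrightarrow> int (card K) \<le> r K + n"
  shows "\<exists>I\<subseteq>E. (\<forall>K\<subseteq>I. int (card K) \<le> r K) \<and> (\<forall>K\<subseteq>E - I. K \<noteq> {} \<longrightarrow> int (card K) \<le> f K)"
  using assms(1-4)
proof (rule submodular_split_undecided)
  show "E \<union> E = E" by simp
  show "int (card K) \<le> r (K \<inter> E) + n" if "K \<subseteq> E" "partition_sum f (K \<inter> E) n" for K n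
    using assms(5)[of K n] that by (simp add: Int_absorb2)
qed

section \<open>The rank function\<close>

context matroid
begin

lemma rank_set: "finite {X. X \<subseteq> A \<and> indep X}" "{X. X \<subseteq> A \<and> indep X} \<noteq> {}"
proof -
  show "finite {X. X \<subseteq> A \<and> indep X}"
    by (rule finite_subset[of _ "Pow carrier"]) (auto simp: finite_carrier dest: indep_subset_carrier)
  show "{X. X \<subseteq> A \<and> indep X} \<noteq> {}" using indep_empty by auto
qed

lemma indep_finite: "indep X \<Longrightarrow> finite X"
  using indep_subset_carrier finite_carrier finite_subset by blast

lemma card_le_rk: "X \<subseteq> A \<Longrightarrow> indep X \<Longrightarrow> card X \<le> rk A"
  unfolding rk_def using rank_set by (auto intro!: Max_ge)

lemma rk_attained: "\<exists>X\<subseteq>A. indep X \<and> card X = rk A"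
proof -
  have "rk A \<in> card ` {X. X \<subseteq> A \<and> indep X}"
    unfolding rk_def using rank_set by (intro Max_in) auto
  then show ?thesis by auto
qed

lemma rk_mono: "A \<subseteq> B \<Longrightarrow> rk A \<le> rk B"
  by (metis rk_attained card_le_rk subset_trans)

lemma rk_le_card: "finite A \<Longrightarrow> rk A \<le> card A"
  by (metis rk_attained card_mono)

lemma rk_empty: "rk {} = 0"
  using rk_le_card[of "{}"] by simp

lemma rk_indep: "indep A \<Longrightarrow> rk A = card A"
  by (meson card_le_rk indep_finite le_antisym order_refl rk_le_card)

lemma indep_if_card_le_rk:
  assumes "finite A" "card A \<le> rk A"
  shows "indep A"
  using assms by (metis rk_attained card_seteq)

lemma indep_extend_to_rk:
  assumes "indep X" "X \<subseteq> A"
  shows "\<exists>Y\<subseteq>A. X \<subseteq> Y \<and> indep Y \<and> card Y = rk A"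
  using assms
proof (induction "rk A - card X" arbitrary: X rule: less_induct)
  case less
  show ?case
  proof (cases "card X = rk A")
    case True
    then show ?thesis using less.prems by auto
  next
    case False
    then have lt: "card X < rk A" using card_le_rk[OF less.prems(2,1)] by simp
    obtain Z where Z: "Z \<subseteq> A" "indep Z" "card Z = rk A" using rk_attained by blast
    then obtain y where y: "y \<in> Z - X" "indep (insert y X)"
      using indep_augment[OF less.prems(1) Z(2)] lt by auto
    have "rk A - card (insert y X) < rk A - card X"
      using y lt indep_finite[OF less.prems(1)] by simp
    from less.hyps[OF this y(2)] obtain Y where "Y \<subseteq> A" "insert y X \<subseteq> Y" "indep Y" "card Y = rk A"
      using y Z less.prems by blast
    then show ?thesis by blast
  qed
qed

lemma rk_submodular: "rk (A \<union> B) + rk (A \<inter> B) \<le> rk A + rk B"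
proof -
  obtain X where X: "X \<subseteq> A \<inter> B" "indep X" "card X = rk (A \<inter> B)" using rk_attained by blast
  then obtain Y where Y: "Y \<subseteq> A \<union> B" "X \<subseteq> Y" "indep Y" "card Y = rk (A \<union> B)"
    using indep_extend_to_rk[of X "A \<union> B"] by blast
  have fin: "finite Y" using Y indep_finite by blast
  have "card (Y \<inter> A) + card (Y \<inter> B) = card (Y \<inter> A \<union> Y \<inter> B) + card ((Y \<inter> A) \<inter> (Y \<inter> B))"
    using fin by (intro card_Un_Int) auto
  moreover have "Y \<inter> A \<union> Y \<inter> B = Y" using Y by auto
  moreover have "card X \<le> card ((Y \<inter> A) \<inter> (Y \<inter> B))" using X Y fin by (intro card_mono) auto
  moreover have "card (Y \<inter> A) \<le> rk A" "card (Y \<inter> B) \<le> rk B"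
    by (auto intro!: card_le_rk indep_subset[OF Y(3)])
  ultimately show ?thesis using X Y by simp
qed

lemma rk_insert_le: "rk (insert x A) \<le> rk A + 1"
proof -
  have "rk {x} \<le> 1" using rk_le_card[of "{x}"] by simp
  then show ?thesis using rk_submodular[of A "{x}"] by simp
qed

section \<open>Removing independent sets from a sparse set\<close>

definition sparse :: "'a set \<Rightarrow> nat \<Rightarrow> nat \<Rightarrow> bool" where
  "sparse E k p \<longleftrightarrow> (\<forall>A\<subseteq>E. A \<noteq> {} \<longrightarrow> int (card A) \<le> int k * int (rk A) - int p)"

lemma intersecting_submodular_rk: "intersecting_submodular (\<lambda>A. int k * int (rk A) - int p)"
  unfolding intersecting_submodular_def
proof (intro allI impI)
  fix A B :: "'a set"
  have "int k * int (rk (A \<union> B) + rk (A \<inter> B)) \<le> int k * int (rk A + rk B)"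
    using rk_submodular[of A B] by (intro mult_left_mono) auto
  then show "int k * int (rk (A \<union> B)) - int p + (int k * int (rk (A \<inter> B)) - int p)
      \<le> int k * int (rk A) - int p + (int k * int (rk B) - int p)"
    by (simp add: algebra_simps)
qed

text \<open>Here \<open>m\<close> is the number of blocks and \<open>S\<close> is the sum of their ranks.\<close>

lemma sparse_partition_sum:
  assumes "partition_sum (\<lambda>A. int l * int (rk A) - int t) K n" "finite K" "K \<subseteq> E" "sparse E k p"
  shows "\<exists>S m :: nat. n = int l * int S - int m * int t \<and>
    int (card K) \<le> int k * int S - int m * int p \<and> rk K \<le> S \<and> (K \<noteq> {} \<longrightarrow> 0 < m)"
  using assms(1-3)
proof induction
  case empty
  show ?case by (intro exI[of _ 0]) (simp add: rk_empty)
next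
  case (add_block A n C)
  then obtain S m :: nat where IH: "n = int l * int S - int m * int t"
    "int (card A) \<le> int k * int S - int m * int p" "rk A \<le> S"
    by auto
  have "int (card C) \<le> int k * int (rk C) - int p"
    using add_block assms(4) unfolding sparse_def by auto
  moreover have "card (A \<union> C) = card A + card C" using add_block by (intro card_Un_disjoint) auto
  moreover have "rk (A \<union> C) \<le> rk A + rk C" using rk_submodular[of A C] by simp
  ultimately show ?case using IH
    by (intro exI[of _ "S + rk C"] exI[of _ "Suc m"]) (simp add: algebra_simps)
qed

text \<open>For a set \<open>I\<close> the inequality \<open>\<bar>I\<bar> \<le> r I\<close> expresses at once that \<open>I\<close> is independent and
  that \<open>x\<close> raises its rank.\<close>

lemma sparse_split_off_avoiding:
  assumes fin: "finite E" and sp: "sparse E (Suc k) (Suc p)" and pk: "p < k" and x: "indep {x}"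
  shows "\<exists>I\<subseteq>E. indep I \<and> x \<notin> closure I \<and> sparse (E - I) k p"
proof -
  define r where "r A = int (rk (insert x A)) - 1" for A
  have "r (A \<union> B) + r (A \<inter> B) \<le> r A + r B" for A B
    using rk_submodular[of "insert x A" "insert x B"] unfolding r_def by simp
  moreover have "r {} = 0" using rk_indep[OF x] unfolding r_def by simp
  moreover have "int (card K) \<le> r K + n"
    if KE: "K \<subseteq> E" and n: "partition_sum (\<lambda>A. int k * int (rk A) - int p) K n" for K n
  proof (cases "K = {}")
    case True
    with n have "n = 0" by cases auto
    then show ?thesis using True \<open>r {} = 0\<close> by simp
  next
    case False
    obtain S m :: nat where S: "n = int k * int S - int m * int p"
      "int (card K) \<le> int (Suc k) * int S - int m * int (Suc p)" "rk K \<le> S" "0 < m"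
      using sparse_partition_sum[OF n finite_subset[OF KE fin] KE sp] False by blast
    have rK: "int (rk K) - 1 \<le> r K" using rk_mono[OF subset_insertI[of K x]] unfolding r_def by linarith
    \<comment> \<open>Passing from the sparsity of the blocks to the values of \<open>f\<close> gains 1 per block and loses
      \<open>S\<close> in total, and \<open>r K \<ge> rk K - 1\<close> is certain to make up for \<open>S - m\<close> only below this threshold.\<close>
    show ?thesis
    proof (cases "S < rk K + m")
      case True
      have "int (card K) \<le> n + (int S - int m)" using S(1,2) by (simp add: algebra_simps)
      then show ?thesis using True rK by linarith
    next
      case False
      have "int k * int (rk K + m) \<le> int k * int S" using False by (intro mult_left_mono) auto
      moreover have "int m * int p + 1 \<le> int m * int k"
      proof -
        have "int m * (int p + 1) \<le> int m * int k" using pk by (intro mult_left_mono) auto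
        then show ?thesis using S(4) by (simp add: algebra_simps)
      qed
      moreover have "int (card K) \<le> int (Suc k) * int (rk K) - int (Suc p)"
        using sp KE \<open>K \<noteq> {}\<close> unfolding sparse_def by blast
      ultimately show ?thesis using S(1) rK by (simp add: algebra_simps)
    qed
  qed
  ultimately have "\<exists>I\<subseteq>E. (\<forall>K\<subseteq>I. int (card K) \<le> r K) \<and>
      (\<forall>K\<subseteq>E - I. K \<noteq> {} \<longrightarrow> int (card K) \<le> int k * int (rk K) - int p)"
    by (intro submodular_split[OF fin _ _ intersecting_submodular_rk])
  then obtain I where I: "I \<subseteq> E" "\<forall>K\<subseteq>I. int (card K) \<le> r K"
    "\<forall>K\<subseteq>E - I. K \<noteq> {} \<longrightarrow> int (card K) \<le> int k * int (rk K) - int p"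
    by blast
  have finI: "finite I" using finite_subset[OF I(1) fin] .
  have "int (card I) \<le> r I" using I(2) by blast
  then have *: "card I < rk (insert x I)" unfolding r_def by linarith
  have "indep I" using * rk_insert_le[of x I] by (intro indep_if_card_le_rk[OF finI]) linarith
  moreover have "rk I < rk (I \<union> {x})" using * rk_le_card[OF finI] by simp
  ultimately have "indep I" "x \<notin> closure I" unfolding closure_def by auto
  moreover have "sparse (E - I) k p" using I(3) unfolding sparse_def .
  ultimately show ?thesis using I(1) by blast
qed

lemma sparse_split_off_indep:
  assumes fin: "finite E" and sp: "sparse E (Suc k) 0"
  shows "\<exists>I\<subseteq>E. indep I \<and> sparse (E - I) k 0"
proof -
  have "int (rk (A \<union> B)) + int (rk (A \<inter> B)) \<le> int (rk A) + int (rk B)" for A B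
    using rk_submodular[of A B] by simp
  moreover have "int (card K) \<le> int (rk K) + n"
    if KE: "K \<subseteq> E" and n: "partition_sum (\<lambda>A. int k * int (rk A) - int 0) K n" for K n
  proof (cases "K = {}")
    case True
    with n have "n = 0" by cases auto
    then show ?thesis using True by simp
  next
    case False
    obtain S m :: nat where S: "n = int k * int S - int m * int 0" "rk K \<le> S"
      using sparse_partition_sum[OF n finite_subset[OF KE fin] KE sp] by blast
    have "int k * int (rk K) \<le> int k * int S" using S by (intro mult_left_mono) auto
    moreover have "int (card K) \<le> int (Suc k) * int (rk K) - int 0"
      using sp KE False unfolding sparse_def by blast
    ultimately show ?thesis using S by (simp add: algebra_simps)
  qed
  moreover have "int (rk {}) = 0" using rk_empty by simp
  ultimately have "\<exists>I\<subseteq>E. (\<forall>K\<subseteq>I. int (card K) \<le> int (rk K)) \<and>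
      (\<forall>K\<subseteq>E - I. K \<noteq> {} \<longrightarrow> int (card K) \<le> int k * int (rk K) - int 0)"
    by (intro submodular_split[OF fin _ _ intersecting_submodular_rk])
  then obtain I where I: "I \<subseteq> E" "\<forall>K\<subseteq>I. int (card K) \<le> int (rk K)"
    "\<forall>K\<subseteq>E - I. K \<noteq> {} \<longrightarrow> int (card K) \<le> int k * int (rk K) - int 0"
    by blast
  have "int (card I) \<le> int (rk I)" using I(2) by blast
  then have "indep I" using finite_subset[OF I(1) fin] by (intro indep_if_card_le_rk) linarith+
  moreover have "sparse (E - I) k 0" using I(3) unfolding sparse_def .
  ultimately show ?thesis using I(1) by blast
qed

text \<open>The truncated subtraction \<open>p - 1\<close> covers both phases: while \<open>p > 0\<close> a point is to be
  avoided, and once \<open>p = 0\<close> it remains 0.\<close>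

lemma sparse_split_off:
  assumes "finite E" "sparse E k p" "p < k" "0 < p \<Longrightarrow> indep {x}"
  shows "\<exists>I\<subseteq>E. indep I \<and> (0 < p \<longrightarrow> x \<notin> closure I) \<and> sparse (E - I) (k - 1) (p - 1)"
proof (cases p)
  case 0
  then show ?thesis using assms sparse_split_off_indep[of E "k - 1"] by simp
next
  case (Suc p')
  then show ?thesis using assms sparse_split_off_avoiding[of E "k - 1" p' x] by simp
qed

text \<open>The starting index \<open>m\<close> serves to continue a sequence of parts that has been fixed before.\<close>

lemma sparse_split_off_sequence:
  assumes "m \<le> n" "finite E" "sparse E (k - m) (p - m)" "p < k" "n \<le> k"
    and "\<And>j. j \<in> {m<..n} \<Longrightarrow> j \<le> p \<Longrightarrow> indep {a j}"
  shows "\<exists>J. disjoint_family_on J {m<..n} \<and>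
    (\<forall>j\<in>{m<..n}. J j \<subseteq> E \<and> indep (J j) \<and> (j \<le> p \<longrightarrow> a j \<notin> closure (J j))) \<and>
    sparse (E - (\<Union>j\<in>{m<..n}. J j)) (k - n) (p - n)"
  using assms(1,5,6)
proof (induction n rule: dec_induct)
  case base
  then show ?case using assms(3) by (auto simp: disjoint_family_on_def)
next
  case (step n)
  have "n \<le> k" "\<And>j. j \<in> {m<..n} \<Longrightarrow> j \<le> p \<Longrightarrow> indep {a j}" using step.prems by simp_all
  from step.IH[OF this] obtain J where J: "disjoint_family_on J {m<..n}"
    "\<forall>j\<in>{m<..n}. J j \<subseteq> E \<and> indep (J j) \<and> (j \<le> p \<longrightarrow> a j \<notin> closure (J j))"
    "sparse (E - (\<Union>j\<in>{m<..n}. J j)) (k - n) (p - n)"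
    by blast
  define R where "R = E - (\<Union>j\<in>{m<..n}. J j)"
  have "\<exists>I\<subseteq>R. indep I \<and> (0 < p - n \<longrightarrow> a (Suc n) \<notin> closure I) \<and> sparse (R - I) (k - n - 1) (p - n - 1)"
  proof (rule sparse_split_off)
    show "finite R" using assms(2) unfolding R_def by simp
    show "sparse R (k - n) (p - n)" using J(3) unfolding R_def .
    show "p - n < k - n" using assms(4) step.prems(1) by simp
    show "indep {a (Suc n)}" if "0 < p - n" using step.prems(2)[of "Suc n"] step.hyps that by simp
  qed
  then obtain I where I: "I \<subseteq> R" "indep I" "0 < p - n \<longrightarrow> a (Suc n) \<notin> closure I"
    "sparse (R - I) (k - n - 1) (p - n - 1)"
    by (elim exE conjE)
  have IE: "I \<subseteq> E" "(\<Union>j\<in>{m<..n}. J j) \<inter> I = {}" using I(1) unfolding R_def by blast+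
  define J' where "J' = J(Suc n := I)"
  have J': "J' (Suc n) = I" "\<And>j. j \<in> {m<..n} \<Longrightarrow> J' j = J j" unfolding J'_def by simp_all
  have ivl: "{m<..Suc n} = insert (Suc n) {m<..n}" using step.hyps by auto
  have Un: "(\<Union>j\<in>{m<..n}. J' j) = (\<Union>j\<in>{m<..n}. J j)" using J'(2) by simp
  have "disjoint_family_on J' {m<..n}" using J(1) J'(2) unfolding disjoint_family_on_def by simp
  then have "disjoint_family_on J' {m<..Suc n}"
    unfolding ivl using IE(2) J'(1) Un by (subst disjoint_family_on_insert) (simp_all add: Int_commute)
  moreover have "\<forall>j\<in>{m<..Suc n}. J' j \<subseteq> E \<and> indep (J' j) \<and> (j \<le> p \<longrightarrow> a j \<notin> closure (J' j))"
    using J(2) I(2,3) IE(1) J' unfolding ivl by simp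
  moreover have "E - (\<Union>j\<in>{m<..Suc n}. J' j) = R - I"
    unfolding ivl R_def using Un J'(1) by auto
  then have "sparse (E - (\<Union>j\<in>{m<..Suc n}. J' j)) (k - Suc n) (p - Suc n)"
    using I(4) by (simp only: Suc_eq_plus1 diff_diff_left)
  ultimately show ?case by blast
qed

lemma sparse_partition:
  assumes "finite E" "sparse E (k - m) (p - m)" "p < k" "m \<le> k"
    and "\<And>j. j \<in> {m<..p} \<Longrightarrow> indep {a j}"
  shows "\<exists>J. disjoint_family_on J {m<..k} \<and> (\<Union>j\<in>{m<..k}. J j) = E \<and>
    (\<forall>j\<in>{m<..k}. indep (J j) \<and> (j \<le> p \<longrightarrow> a j \<notin> closure (J j)))"
proof -
  have "\<And>j. j \<in> {m<..k} \<Longrightarrow> j \<le> p \<Longrightarrow> indep {a j}" using assms(5) by auto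
  from sparse_split_off_sequence[where a = a, OF assms(4,1-3) order_refl this] obtain J where J:
    "disjoint_family_on J {m<..k}"
    "\<forall>j\<in>{m<..k}. J j \<subseteq> E \<and> indep (J j) \<and> (j \<le> p \<longrightarrow> a j \<notin> closure (J j))"
    "sparse (E - (\<Union>j\<in>{m<..k}. J j)) (k - k) (p - k)"
    by blast
  have "E - (\<Union>j\<in>{m<..k}. J j) = {}"
  proof (rule ccontr)
    assume "E - (\<Union>j\<in>{m<..k}. J j) \<noteq> {}"
    moreover from this have "int (card (E - (\<Union>j\<in>{m<..k}. J j))) \<le>
        int (k - k) * int (rk (E - (\<Union>j\<in>{m<..k}. J j))) - int (p - k)"
      using J(3) unfolding sparse_def by blast
    then have "card (E - (\<Union>j\<in>{m<..k}. J j)) = 0" by simp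
    moreover have "finite (E - (\<Union>j\<in>{m<..k}. J j))" using assms(1) by simp
    ultimately show False by (simp only: card_0_eq)
  qed
  then have "(\<Union>j\<in>{m<..k}. J j) = E" using J(2) by blast
  with J(1,2) show ?thesis by (intro exI[of _ J]) simp
qed

end

section \<open>Partitions avoiding the entries of a tuple\<close>

theorem theorem2p3:
  fixes Et :: "'a set" and indep :: "'a set \<Rightarrow> bool"
    and k p q :: nat and E :: "'a set" and e :: "nat \<Rightarrow> 'a"
  assumes "matroid Et indep"
    and "Et \<noteq> {}"
    and "E \<subseteq> Et" and "E \<noteq> {}"
    and "\<And>A. A \<subseteq> E \<Longrightarrow> A \<noteq> {} \<Longrightarrow>
           int (card A) \<le> int k * int (matroid.rk indep A) - int p"
    and "q \<le> p"
    and "e \<in> {1..q} \<rightarrow> Et"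
  shows "\<exists>It :: nat \<Rightarrow> 'a set.
           disjoint_family_on It {1..q} \<and>
           (\<forall>j\<in>{1..q}. It j \<subseteq> E \<and> indep (It j)) \<and>
           (\<forall>a \<in> {1..p} \<rightarrow> Et.
              (\<forall>i\<in>{1..q}. a i = e i) \<longrightarrow>
              (\<forall>j\<in>{1..p}. \<not> matroid.loop Et indep (a j)) \<longrightarrow>
              (\<exists>I :: nat \<Rightarrow> 'a set.
                 disjoint_family_on I {1..k} \<and>
                 (\<Union>j\<in>{1..k}. I j) = E \<and>
                 (\<forall>j\<in>{1..k}. indep (I j)) \<and>
                 (\<forall>j\<in>{1..p}. a j \<notin> matroid.closure Et indep (I j)) \<and>
                 (\<forall>j\<in>{1..q}. I j = It j)))"
proof -
  interpret matroid Et indep by fact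
  have fin: "finite E" using assms(3) finite_carrier finite_subset by blast
  have sp: "sparse E k p" unfolding sparse_def using assms(5) by blast
  \<comment> \<open>A single element has rank at most 1, so its sparsity inequality reads \<open>1 \<le> k - p\<close>.\<close>
  have pk: "p < k"
  proof -
    obtain x where "x \<in> E" using assms(4) by blast
    then have "int 1 \<le> int k * int (rk {x}) - int p" using assms(5)[of "{x}"] by simp
    moreover have "int k * int (rk {x}) \<le> int k * 1"
      using rk_le_card[of "{x}"] by (intro mult_left_mono) auto
    ultimately show ?thesis by linarith
  qed
  have ivl: "{1..n} = {0<..n}" for n :: nat by auto
  show ?thesis
  proof (cases "\<forall>j\<in>{1..q}. indep {e j}")
    case False
    \<comment> \<open>No tuple of non-loops extends \<open>e\<close>, and any choice of the parts will do.\<close>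
    then obtain i where i: "i \<in> {1..q}" "\<not> indep {e i}" by blast
    have loop: "loop (e i)" using i(2) Pi_mem[OF assms(7) i(1)] unfolding loop_def by blast
    have ip: "i \<in> {1..p}" using i(1) assms(6) by simp
    show ?thesis
    proof (rule exI[of _ "\<lambda>_. {}"], intro conjI ballI impI)
      show "disjoint_family_on (\<lambda>_. {}) {1..q}" by (simp add: disjoint_family_on_def)
      fix a assume "\<forall>i\<in>{1..q}. a i = e i" "\<forall>j\<in>{1..p}. \<not> loop (a j)"
      then have False using loop ip i(1) by fastforce
      then show "\<exists>I. disjoint_family_on I {1..k} \<and> (\<Union>j\<in>{1..k}. I j) = E \<and>
          (\<forall>j\<in>{1..k}. indep (I j)) \<and> (\<forall>j\<in>{1..p}. a j \<notin> closure (I j)) \<and> (\<forall>j\<in>{1..q}. I j = {})" ..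
    qed (simp_all add: indep_empty)
  next
    case True
    have "sparse E (k - 0) (p - 0)" "q \<le> k" using sp pk assms(6) by simp_all
    moreover have "\<And>j. j \<in> {0<..q} \<Longrightarrow> j \<le> p \<Longrightarrow> indep {e j}" using True by simp
    ultimately obtain It where It: "disjoint_family_on It {1..q}"
      "\<forall>j\<in>{1..q}. It j \<subseteq> E \<and> indep (It j) \<and> (j \<le> p \<longrightarrow> e j \<notin> closure (It j))"
      "sparse (E - (\<Union>j\<in>{1..q}. It j)) (k - q) (p - q)"
      using sparse_split_off_sequence[where m = 0 and n = q and a = e, OF le0 fin _ pk] unfolding ivl by blast
    let ?R = "E - (\<Union>j\<in>{1..q}. It j)"
    have parts: "\<exists>I. disjoint_family_on I {1..k} \<and> (\<Union>j\<in>{1..k}. I j) = E \<and> (\<forall>j\<in>{1..k}. indep (I j)) \<and>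
        (\<forall>j\<in>{1..p}. a j \<notin> closure (I j)) \<and> (\<forall>j\<in>{1..q}. I j = It j)"
      if a: "a \<in> {1..p} \<rightarrow> Et" "\<forall>i\<in>{1..q}. a i = e i" "\<forall>j\<in>{1..p}. \<not> loop (a j)" for a
    proof -
      have "finite ?R" "q \<le> k" using fin pk assms(6) by simp_all
      moreover have "indep {a j}" if "j \<in> {q<..p}" for j
      proof -
        have "j \<in> {1..p}" using that by simp
        then show ?thesis using Pi_mem[OF a(1)] a(3) unfolding loop_def by blast
      qed
      ultimately obtain J where J: "disjoint_family_on J {q<..k}" "(\<Union>j\<in>{q<..k}. J j) = ?R"
        "\<forall>j\<in>{q<..k}. indep (J j) \<and> (j \<le> p \<longrightarrow> a j \<notin> closure (J j))"
        using sparse_partition[where a = a, OF _ It(3) pk] by blast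
      define I where "I j = (if j \<le> q then It j else J j)" for j
      have split: "{1..k} = {1..q} \<union> {q<..k}" using pk assms(6) by auto
      have I: "\<And>j. j \<in> {1..q} \<Longrightarrow> I j = It j" "\<And>j. j \<in> {q<..k} \<Longrightarrow> I j = J j"
        unfolding I_def by auto
      have "(\<Union>j\<in>{1..k}. I j) = (\<Union>j\<in>{1..q}. It j) \<union> (\<Union>j\<in>{q<..k}. J j)"
        unfolding split using I by auto
      also have "\<dots> = E" using J(2) It(2) by auto
      finally have "(\<Union>j\<in>{1..k}. I j) = E" .
      moreover have "disjoint_family_on I {1..k}"
      proof -
        have cross: "It i \<inter> J j = {}" if "i \<in> {1..q}" "j \<in> {q<..k}" for i j
          using J(2) that by blast
        show ?thesis unfolding disjoint_family_on_def split
        proof (intro ballI impI)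
          fix i j assume ij: "i \<in> {1..q} \<union> {q<..k}" "j \<in> {1..q} \<union> {q<..k}" "i \<noteq> j"
          then consider "i \<in> {1..q}" "j \<in> {1..q}" | "i \<in> {1..q}" "j \<in> {q<..k}"
            | "i \<in> {q<..k}" "j \<in> {1..q}" | "i \<in> {q<..k}" "j \<in> {q<..k}" by (elim UnE)
          then show "I i \<inter> I j = {}"
          proof cases
            case 1
            then show ?thesis using disjoint_family_onD[OF It(1) 1 ij(3)] I(1) by simp
          next
            case 2
            then show ?thesis using cross I by simp
          next
            case 3
            then show ?thesis using cross[OF 3(2,1)] I by (simp add: Int_commute)
          next
            case 4
            then show ?thesis using disjoint_family_onD[OF J(1) 4 ij(3)] I(2) by simp
          qed
        qed
      qed
      moreover have "\<forall>j\<in>{1..k}. indep (I j)" unfolding split using I It(2) J(3) by (simp add: ball_Un)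
      moreover have "a j \<notin> closure (I j)" if "j \<in> {1..p}" for j
      proof (cases "j \<le> q")
        case True
        then have "j \<in> {1..q}" using that by simp
        then show ?thesis using that I(1)[of j] It(2) a(2) by fastforce
      next
        case False
        then have "j \<in> {q<..k}" "j \<le> p" using that pk by simp_all
        then show ?thesis using I(2)[of j] J(3) by simp
      qed
      ultimately show ?thesis using I(1) by (intro exI[of _ I]) simp
    qed
    show ?thesis
    proof (rule exI[of _ It], intro conjI ballI impI)
      show "It j \<subseteq> E" "indep (It j)" if "j \<in> {1..q}" for j using It(2) that by simp_all
    qed (use It(1) parts in simp_all)
  qed
qed

end
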